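(* Let $\mathcal{H}$ be a real Hilbert space, let $m\ge1$ be an integer and $\mathrm{I}:=\{1,\ldots,m\}$. For every $i\in\mathrm{I}$ let $\gamma_i\in[0,1[$ and let $G_i:\mathcal{H}\to\mathcal{H}$ be a $\gamma_i$-BAM such that $U_i:=\operatorname{Fix}G_i$ is a closed affine subspace of $\mathcal{H}$, with $\bigcap_{i\in\mathrm{I}}U_i\ne\varnothing$. Assume that for every $i\in\mathrm{I}$ the sum $\sum_{j=1}^{i}(\operatorname{par}U_j)^\perp$ is closed. Then the following hold: (i) For every $k\in\{1,\ldots,m\}$, $\operatorname{Fix}(G_k\circ\cdots\circ G_1)=\bigcap_{i=1}^k\operatorname{Fix}G_i$ is a closed affine subspace of $\mathcal{H}$. (ii) $G_m\circ\cdots\circ G_2\circ G_1$ is a BAM. (iii) Suppose that $m=2$. Let $c_F:=c(\operatorname{par}U_1,\operatorname{par}U_2)$ be the cosine of the Friedrichs angle between $\operatorname{par}U_1$ and $\operatorname{par}U_2$, and set $$r:=\max_{i\in\mathrm{I}}\sqrt{\gamma_i^2+(1-\gamma_i^2)\tfrac{1+c_F}{2}},\qquad s:=\sqrt{\gamma_1^2+\gamma_2^2-\gamma_1^2\gamma_2^2+(1-\gamma_1^2)(1-\gamma_2^2)\tfrac{(1+c_F)^2}{4}}.$$ Then $\min\{r,s\}\in[0,1[$ and $G_2\circ G_1$ is a $\min\{r,s\}$-BAM. (iv) There exists $\gamma\in[0,1[$ such that $$(\forall x\in\mathcal{H})(\forall k\in\mathbb{N})\quad\left\|(G_m\circ\cdots\circ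 G_2\circ G_1)^kx-\mathrm{P}_{\bigcap_{i=1}^mU_i}x\right\|\le\gamma^k\left\|x-\mathrm{P}_{\bigcap_{i=1}^mU_i}x\right\|.$$
   Context: For a nonempty closed convex set $C\subseteq\mathcal{H}$, $\mathrm{P}_C$ denotes the metric projection onto $C$. $\operatorname{Fix}G=\{x\in\mathcal{H}: Gx=x\}$. For an affine subspace $U$ (nonempty by convention), $\operatorname{par}U=U-u$ (any $u\in U$) is the linear subspace parallel to $U$. $\mathbb{N}=\{0,1,2,\ldots\}$. Definition (BAM). Let $G:\mathcal{H}\to\mathcal{H}$ and $\gamma\in[0,1[$. $G$ is a best approximation mapping with constant $\gamma$ ($\gamma$-BAM) if (1) $\operatorname{Fix}G$ is a nonempty closed convex subset of $\mathcal{H}$; (2) $\mathrm{P}_{\operatorname{Fix}G}G=\mathrm{P}_{\operatorname{Fix}G}$; (3) $\|Gx-\mathrm{P}_{\operatorname{Fix}G}x\|\le\gamma\|x-\mathrm{P}_{\operatorname{Fix}G}x\|$ for all $x\in\mathcal{H}$. $G$ is a BAM if it is a $\gamma$-BAM for some $\gamma\in[0,1[$. Friedrichs angle: for linear subspaces $U,V$ of $\mathcal{H}$, $c(U,V):=\sup\{|\langle u,v\rangle| : u\in U\cap(U\cap V)^\perp,\ v\in V\cap(U\cap V)^\perp,\ \|u\|\le1,\ \|v\|\le1\}$. *)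

theory Defs
  imports "HOL-Analysis.Analysis"
begin

(* A real Hilbert space is a type of sort {real_inner, complete_space}. *)

definition Fix :: "('a \<Rightarrow> 'a) \<Rightarrow> 'a set" where
  "Fix G = {x. G x = x}"

(* The library's closest_point is restricted to Heine-Borel spaces, i.e. to finite dimension. *)
definition metric_proj :: "'a::metric_space set \<Rightarrow> 'a \<Rightarrow> 'a" where
  "metric_proj C x = (THE p. p \<in> C \<and> (\<forall>y\<in>C. dist x p \<le> dist x y))"

(* The library predicate affine also holds of the empty set. *)
definition closed_affine_subspace :: "'a::real_normed_vector set \<Rightarrow> bool" where
  "closed_affine_subspace U \<longleftrightarrow> affine U \<and> closed U \<and> U \<noteq> {}"

definition par :: "'a::real_vector set \<Rightarrow> 'a set" where
  "par U = (\<lambda>x. x - (SOME u. u \<in> U)) ` U"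

lemma par_eq:
  assumes "affine U" "u \<in> U"
  shows "par U = (\<lambda>x. x - u) ` U"
proof -
  have sub: "(\<lambda>x. x - a) ` U \<subseteq> (\<lambda>x. x - b) ` U" if "a \<in> U" "b \<in> U" for a b
  proof
    fix z assume "z \<in> (\<lambda>x. x - a) ` U"
    then obtain x where x: "x \<in> U" "z = x - a" by blast
    have "x - a + b \<in> U"
      using mem_affine_3_minus[OF assms(1) that(2) x(1) that(1), of 1] by (simp add: algebra_simps)
    then show "z \<in> (\<lambda>x. x - b) ` U"
      using x(2) by (intro image_eqI[of _ _ "x - a + b"]) auto
  qed
  have "(SOME u. u \<in> U) \<in> U"
    using assms(2) by (rule someI)
  then show ?thesis
    unfolding par_def using sub assms(2) by blast
qed

definition is_BAM_with :: "real \<Rightarrow> ('a::{real_inner,complete_space} \<Rightarrow> 'a) \<Rightarrow> bool" where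
  "is_BAM_with \<gamma> G \<longleftrightarrow>
     0 \<le> \<gamma> \<and> \<gamma> < 1 \<and>
     Fix G \<noteq> {} \<and> closed (Fix G) \<and> convex (Fix G) \<and>
     metric_proj (Fix G) \<circ> G = metric_proj (Fix G) \<and>
     (\<forall>x. norm (G x - metric_proj (Fix G) x) \<le> \<gamma> * norm (x - metric_proj (Fix G) x))"

definition is_BAM :: "('a::{real_inner,complete_space} \<Rightarrow> 'a) \<Rightarrow> bool" where
  "is_BAM G \<longleftrightarrow> (\<exists>\<gamma>. is_BAM_with \<gamma> G)"

definition friedrichs_cos :: "'a::real_inner set \<Rightarrow> 'a set \<Rightarrow> real" where
  "friedrichs_cos U V =
     Sup {\<bar>u \<bullet> v\<bar> | u v. u \<in> U \<inter> orthogonal_comp (U \<inter> V) \<and>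
                       v \<in> V \<inter> orthogonal_comp (U \<inter> V) \<and>
                       norm u \<le> 1 \<and> norm v \<le> 1}"

(* comp_upto G k is the composition of G k, ..., G 2, G 1, where G 1 is applied first. *)
primrec comp_upto :: "(nat \<Rightarrow> 'a \<Rightarrow> 'a) \<Rightarrow> nat \<Rightarrow> 'a \<Rightarrow> 'a" where
  "comp_upto G 0 = id"
| "comp_upto G (Suc k) = G (Suc k) \<circ> comp_upto G k"

end

theory Submission
  imports Defs
begin

text \<open>Let \<open>x\<close> be a point, \<open>y = G1 x\<close> and \<open>z = G2 y\<close>, with the projection of \<open>x\<close> onto \<open>Fix G1 \<inter> Fix G2\<close>
  as origin; \<open>y\<close> and \<open>z\<close> have the same projection. Split \<open>x = p1 + q1\<close>, \<open>y = p1 + q1' = p2 + q2\<close>,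
  \<open>z = p2 + q2'\<close> into components along and orthogonal to the fixed spaces, so that \<open>G1\<close> and \<open>G2\<close>
  contract only the \<open>q\<close>-parts and the Friedrichs angle enters only through
  \<open>\<bar>p1 \<bullet> p2\<bar> \<le> c * norm p1 * norm p2\<close>. This gives \<open>s\<close> even with \<open>c\<^sup>2\<close> in place of \<open>(1 + c)\<^sup>2 / 4\<close>, and
  \<open>r\<close> with \<open>c\<close> in place of \<open>(1 + c) / 2\<close>. The angle satisfies \<open>c < 1\<close> because the sum of the orthogonal
  complements is closed, and that sum is the orthogonal complement of the intersection, so that the
  case of two maps can be iterated.\<close>

section \<open>Metric projections in Hilbert spaces\<close>

text \<open>Cantor's nested set argument: the sets of near-minimizers are closed, nonempty and, by
  the parallelogram law, of diameter tending to 0. This makes the \<open>THE\<close> in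
  \<open>metric_proj\<close> denote.\<close>

lemma metric_proj_ex1:
  fixes C :: "'a::{real_inner,complete_space} set"
  assumes "closed C" "convex C" "C \<noteq> {}"
  shows "\<exists>!p. p \<in> C \<and> (\<forall>y\<in>C. dist x p \<le> dist x y)"
proof -
  define d where "d = infdist x C"
  have d_le: "d\<^sup>2 \<le> (dist x y)\<^sup>2" if "y \<in> C" for y
    unfolding d_def using infdist_le[OF that] infdist_nonneg by (intro power_mono) auto
  \<comment> \<open>Parallelogram law: by convexity the midpoint of \<open>y\<close> and
    \<open>z\<close> lies in \<open>C\<close>, hence at distance at least \<open>d\<close> from
    \<open>x\<close>. Shrinking of the sets \<open>S n\<close> and uniqueness both rest on
    this.\<close>
  have gap: "(dist y z)\<^sup>2 \<le> 2 * (dist x y)\<^sup>2 + 2 * (dist x z)\<^sup>2 - 4 * d\<^sup>2"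
    if "y \<in> C" "z \<in> C" for y z
  proof -
    have "(1/2) *\<^sub>R y + (1/2) *\<^sub>R z \<in> C"
      using convexD[OF assms(2) that, of "1/2" "1/2"] by simp
    note d_le[OF this]
    moreover have "4 * (dist x ((1/2) *\<^sub>R y + (1/2) *\<^sub>R z))\<^sup>2
        = 2 * (dist x y)\<^sup>2 + 2 * (dist x z)\<^sup>2 - (dist y z)\<^sup>2"
      by (simp add: dist_norm power2_norm_eq_inner inner_diff_left inner_diff_right
          inner_add_left inner_add_right inner_commute field_simps)
    ultimately show ?thesis by linarith
  qed
  \<comment> \<open>The slack is put on the squared distance, so that \<open>gap\<close> bounds the
    squared diameter of \<open>S n\<close> by 4 / (n + 1).\<close>
  define S where "S n = {y \<in> C. (dist x y)\<^sup>2 \<le> d\<^sup>2 + inverse (real (Suc n))}" for n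
  have "\<exists>a. \<forall>n. a \<in> S n"
  proof (rule decreasing_closed_nest[of S])
    show "closed (S n)" for n
    proof -
      have "S n = C \<inter> {y. (dist x y)\<^sup>2 \<le> d\<^sup>2 + inverse (real (Suc n))}"
        by (auto simp: S_def)
      then show ?thesis
        using assms(1) by (auto intro!: closed_Int closed_Collect_le continuous_intros)
    qed
    show "S n \<noteq> {}" for n
    proof -
      have "d < sqrt (d\<^sup>2 + inverse (real (Suc n)))"
        by (rule real_less_rsqrt) simp
      then obtain y where y: "y \<in> C" "dist x y < sqrt (d\<^sup>2 + inverse (real (Suc n)))"
        using assms(3) by (auto simp: d_def infdist_def cINF_less_iff)
      have "(dist x y)\<^sup>2 \<le> (sqrt (d\<^sup>2 + inverse (real (Suc n))))\<^sup>2"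
        using y(2) by (intro power_mono) auto
      also have "\<dots> = d\<^sup>2 + inverse (real (Suc n))"
        by (simp add: add_nonneg_nonneg del: of_nat_Suc)
      finally show ?thesis using y(1) by (auto simp: S_def)
    qed
    show "S n \<subseteq> S m" if "m \<le> n" for m n
    proof -
      have "inverse (real (Suc n)) \<le> inverse (real (Suc m))"
        using that by (intro le_imp_inverse_le) auto
      then have "d\<^sup>2 + inverse (real (Suc n)) \<le> d\<^sup>2 + inverse (real (Suc m))" by simp
      then show ?thesis unfolding S_def using order_trans by blast
    qed
    show "\<exists>n. \<forall>y\<in>S n. \<forall>z\<in>S n. dist y z < e" if "e > 0" for e :: real
    proof -
      have "e\<^sup>2 / 4 > 0" using that by simp
      then obtain n where n: "inverse (real (Suc n)) < e\<^sup>2 / 4"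
        using reals_Archimedean by blast
      have "dist y z < e" if yz: "y \<in> S n" "z \<in> S n" for y z
      proof (rule power2_less_imp_less)
        show "(dist y z)\<^sup>2 < e\<^sup>2"
          using gap[of y z] yz n unfolding S_def by auto
      qed (use \<open>e > 0\<close> in simp)
      then show ?thesis by blast
    qed
  qed blast
  then obtain p where p: "\<And>n. p \<in> S n" by blast
  have d2: "(dist x p)\<^sup>2 \<le> d\<^sup>2 + 0"
  proof (rule tendsto_lowerbound)
    show "((\<lambda>n. d\<^sup>2 + inverse (real (Suc n))) \<longlongrightarrow> d\<^sup>2 + 0) sequentially"
      by (intro tendsto_intros LIMSEQ_inverse_real_of_nat)
    show "\<forall>\<^sub>F n in sequentially. (dist x p)\<^sup>2 \<le> d\<^sup>2 + inverse (real (Suc n))"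
      using p by (auto simp: S_def)
  qed simp
  have p_le: "dist x p \<le> d"
    by (rule power2_le_imp_le) (use d2 infdist_nonneg in \<open>auto simp: d_def\<close>)
  show ?thesis
  proof (intro ex1I[of _ p] conjI ballI)
    show pC: "p \<in> C" using p[of 0] by (simp add: S_def)
    show "dist x p \<le> dist x y" if "y \<in> C" for y
      using p_le infdist_le[OF that, of x] by (simp add: d_def)
    fix q assume q: "q \<in> C \<and> (\<forall>y\<in>C. dist x q \<le> dist x y)"
    with pC have "dist x q \<le> dist x p" by blast
    with p_le have "dist x q \<le> d" by linarith
    then have "(dist x q)\<^sup>2 \<le> d\<^sup>2" "(dist x p)\<^sup>2 \<le> d\<^sup>2"
      using p_le by (auto intro!: power_mono)
    then have "(dist q p)\<^sup>2 \<le> 0" using gap[of q p] q pC by linarith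
    then show "q = p" by simp
  qed
qed

lemma
  fixes C :: "'a::{real_inner,complete_space} set"
  assumes "closed C" "convex C" "C \<noteq> {}"
  shows metric_proj_in: "metric_proj C x \<in> C"
    and metric_proj_le: "y \<in> C \<Longrightarrow> dist x (metric_proj C x) \<le> dist x y"
  using theI'[OF metric_proj_ex1[OF assms, of x]] by (simp_all add: metric_proj_def)

lemma metric_proj_eqI:
  fixes C :: "'a::{real_inner,complete_space} set"
  assumes "closed C" "convex C" "p \<in> C" "\<And>y. y \<in> C \<Longrightarrow> dist x p \<le> dist x y"
  shows "metric_proj C x = p"
  unfolding metric_proj_def
  using metric_proj_ex1[of C x] assms by (intro the1_equality) auto

lemma closed_affine_subspace_subspace:
  "subspace L \<Longrightarrow> closed L \<Longrightarrow> closed_affine_subspace L"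
  using subspace_0 by (auto simp: closed_affine_subspace_def subspace_imp_affine)

lemma closed_affine_subspace_Int:
  assumes "closed_affine_subspace U" "closed_affine_subspace V" "U \<inter> V \<noteq> {}"
  shows "closed_affine_subspace (U \<inter> V)"
  using assms by (auto simp: closed_affine_subspace_def intro: affine_Int)

lemma mem_affine_translate:
  assumes "affine U" "u \<in> U" "v \<in> U" "w \<in> U"
  shows "u + t *\<^sub>R (v - w) \<in> U"
  using mem_affine_3_minus[OF assms] by simp

context
  fixes U :: "'a::{real_inner,complete_space} set"
  assumes U: "closed_affine_subspace U"
begin

lemma closed_affine_subspace_rules:
  "affine U" "closed U" "convex U" "U \<noteq> {}"
  using U by (auto simp: closed_affine_subspace_def affine_imp_convex)

lemma metric_proj_affine_in: "metric_proj U x \<in> U"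
  using closed_affine_subspace_rules by (intro metric_proj_in)

text \<open>First variation: if the residual had a component along the direction
  \<open>u - v\<close>, moving the projection inside \<open>U\<close> in that direction would bring
  it strictly closer to \<open>x\<close>.\<close>

lemma metric_proj_affine_orthogonal:
  assumes "u \<in> U" "v \<in> U"
  shows "(x - metric_proj U x) \<bullet> (u - v) = 0"
proof (rule ccontr)
  define q where "q = x - metric_proj U x"
  define w where "w = u - v"
  assume "(x - metric_proj U x) \<bullet> (u - v) \<noteq> 0"
  then have nz: "q \<bullet> w \<noteq> 0" by (simp add: q_def w_def)
  then have w0: "w \<bullet> w > 0" by auto
  \<comment> \<open>This \<open>t\<close> minimizes the norm of
    \<open>q - t *\<^sub>R w\<close>.\<close>
  define t where "t = (q \<bullet> w) / (w \<bullet> w)"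
  have "metric_proj U x + t *\<^sub>R w \<in> U"
    unfolding w_def
    using mem_affine_translate[OF closed_affine_subspace_rules(1) metric_proj_affine_in assms] .
  from metric_proj_le[OF closed_affine_subspace_rules(2-4) this, of x]
  have "norm q \<le> norm (q - t *\<^sub>R w)"
    by (simp add: dist_norm q_def algebra_simps)
  then have "(norm q)\<^sup>2 \<le> (norm (q - t *\<^sub>R w))\<^sup>2" by (simp add: power_mono)
  also have "\<dots> = (norm q)\<^sup>2 - 2 * t * (q \<bullet> w) + t\<^sup>2 * (w \<bullet> w)"
    by (simp add: power2_norm_eq_inner inner_diff_left inner_diff_right inner_commute)
      (simp add: power2_eq_square)
  also have "\<dots> = (norm q)\<^sup>2 - (q \<bullet> w)\<^sup>2 / (w \<bullet> w)"
    using w0 by (simp add: t_def power2_eq_square)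
  finally have "(q \<bullet> w)\<^sup>2 / (w \<bullet> w) \<le> 0" by simp
  moreover have "(q \<bullet> w)\<^sup>2 / (w \<bullet> w) > 0" using nz w0 by simp
  ultimately show False by linarith
qed

lemma metric_proj_affine_eqI:
  assumes "p \<in> U" "\<And>u. u \<in> U \<Longrightarrow> (x - p) \<bullet> (u - p) = 0"
  shows "metric_proj U x = p"
proof (rule metric_proj_eqI)
  fix y assume "y \<in> U"
  then have "(x - p) \<bullet> (y - p) = 0" by (rule assms)
  then have "(norm (x - y))\<^sup>2 = (norm (x - p))\<^sup>2 + (norm (y - p))\<^sup>2"
    by (simp add: power2_norm_eq_inner inner_diff_left inner_diff_right inner_commute)
  then have "(norm (x - p))\<^sup>2 \<le> (norm (x - y))\<^sup>2" by simp
  then show "dist x p \<le> dist x y"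
    unfolding dist_norm by (rule power2_le_imp_le) simp
qed (use closed_affine_subspace_rules assms in auto)

end

lemma metric_proj_subspace_orthogonal:
  fixes L :: "'a::{real_inner,complete_space} set"
  assumes "subspace L" "closed L" "v \<in> L"
  shows "(x - metric_proj L x) \<bullet> v = 0"
  using metric_proj_affine_orthogonal[OF closed_affine_subspace_subspace, of L v 0 x]
    assms subspace_0 by auto

section \<open>Orthogonal complements and the Friedrichs angle\<close>

lemma mem_orthogonal_comp: "x \<in> orthogonal_comp W \<longleftrightarrow> (\<forall>w\<in>W. x \<bullet> w = 0)"
  by (auto simp: orthogonal_comp_def orthogonal_def inner_commute)

lemma closed_orthogonal_comp: "closed (orthogonal_comp W)"
proof -
  have "orthogonal_comp W = (\<Inter>w\<in>W. {x. x \<bullet> w = 0})"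
    by (auto simp: mem_orthogonal_comp)
  then show ?thesis by (auto intro!: closed_INT closed_Collect_eq continuous_intros)
qed

text \<open>For \<open>x\<close> in the double complement, the residual of its projection onto
  \<open>L\<close> is orthogonal to \<open>x\<close> and to the projection, hence to itself, so it
  vanishes.\<close>

lemma orthogonal_comp_comp:
  fixes L :: "'a::{real_inner,complete_space} set"
  assumes "subspace L" "closed L"
  shows "orthogonal_comp (orthogonal_comp L) = L"
proof
  show "orthogonal_comp (orthogonal_comp L) \<subseteq> L"
  proof
    fix x assume x: "x \<in> orthogonal_comp (orthogonal_comp L)"
    define p where "p = metric_proj L x"
    have p: "p \<in> L" "\<And>v. v \<in> L \<Longrightarrow> (x - p) \<bullet> v = 0"
      using metric_proj_affine_in[OF closed_affine_subspace_subspace]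
        metric_proj_subspace_orthogonal assms by (auto simp: p_def)
    then have "x - p \<in> orthogonal_comp L" by (simp add: mem_orthogonal_comp)
    then have "x \<bullet> (x - p) = 0" using x by (simp add: mem_orthogonal_comp)
    moreover have "(x - p) \<bullet> p = 0" using p by blast
    ultimately have "(x - p) \<bullet> (x - p) = 0"
      by (simp add: inner_diff_left inner_diff_right inner_commute)
    then show "x \<in> L" using p(1) by simp
  qed
qed (rule orthogonal_comp_subset)

lemma subspace_set_plus:
  assumes "subspace A" "subspace B"
  shows "subspace (A + B)"
proof -
  have "A + B = {x + y |x y. x \<in> A \<and> y \<in> B}" by (auto simp: set_plus_def)
  then show ?thesis using subspace_sums[OF assms] by simp
qed

text \<open>The complement of the sum is \<open>U \<inter> V\<close>; since the sum is closed, a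
  second complement returns the sum itself.\<close>

lemma orthogonal_comp_Int:
  fixes U V :: "'a::{real_inner,complete_space} set"
  assumes "subspace U" "closed U" "subspace V" "closed V"
    and cl: "closed (orthogonal_comp U + orthogonal_comp V)"
  shows "orthogonal_comp (U \<inter> V) = orthogonal_comp U + orthogonal_comp V" (is "_ = ?S")
proof -
  have "orthogonal_comp ?S = U \<inter> V"
  proof
    have 0: "0 \<in> orthogonal_comp U" "0 \<in> orthogonal_comp V"
      by (simp_all add: mem_orthogonal_comp)
    have "orthogonal_comp U \<subseteq> ?S"
      using 0 set_plus_intro[OF _ 0(2), of _ "orthogonal_comp U"] by auto
    moreover have "orthogonal_comp V \<subseteq> ?S"
      using 0 set_plus_intro[OF 0(1), of _ "orthogonal_comp V"] by auto
    ultimately show "orthogonal_comp ?S \<subseteq> U \<inter> V"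
      using orthogonal_comp_anti_mono orthogonal_comp_comp assms(1-4) by blast
    show "U \<inter> V \<subseteq> orthogonal_comp ?S"
    proof
      fix x assume x: "x \<in> U \<inter> V"
      have "x \<bullet> (a + b) = 0" if "a \<in> orthogonal_comp U" "b \<in> orthogonal_comp V" for a b
        using that x by (simp add: mem_orthogonal_comp inner_add_right inner_commute[of x])
      then show "x \<in> orthogonal_comp ?S"
        by (auto simp: mem_orthogonal_comp elim!: set_plus_elim)
    qed
  qed
  moreover have "subspace ?S"
    by (intro subspace_set_plus subspace_orthogonal_comp)
  ultimately show ?thesis using orthogonal_comp_comp[OF _ cl] by simp
qed

lemma friedrichs_cos_le:
  fixes U V :: "'a::real_inner set"
  assumes "subspace U" "subspace V"
    and "\<And>u v. \<lbrakk>u \<in> U \<inter> orthogonal_comp (U \<inter> V); v \<in> V \<inter> orthogonal_comp (U \<inter> V);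
      norm u \<le> 1; norm v \<le> 1\<rbrakk> \<Longrightarrow> \<bar>u \<bullet> v\<bar> \<le> b"
  shows "friedrichs_cos U V \<le> b"
  unfolding friedrichs_cos_def
proof (rule cSup_least)
  have "0 \<in> U \<inter> orthogonal_comp (U \<inter> V)" "0 \<in> V \<inter> orthogonal_comp (U \<inter> V)"
    using assms(1,2) by (auto simp: subspace_0 subspace_orthogonal_comp)
  then show "{\<bar>u \<bullet> v\<bar> | u v. u \<in> U \<inter> orthogonal_comp (U \<inter> V) \<and>
      v \<in> V \<inter> orthogonal_comp (U \<inter> V) \<and> norm u \<le> 1 \<and> norm v \<le> 1} \<noteq> {}"
    by fastforce
qed (use assms(3) in blast)

text \<open>Cauchy-Schwarz bounds the set by 1, so its real supremum is a genuine upper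
  bound.\<close>

lemma friedrichs_cos_ge:
  fixes U V :: "'a::real_inner set"
  assumes "u \<in> U \<inter> orthogonal_comp (U \<inter> V)" "v \<in> V \<inter> orthogonal_comp (U \<inter> V)"
    and "norm u \<le> 1" "norm v \<le> 1"
  shows "\<bar>u \<bullet> v\<bar> \<le> friedrichs_cos U V"
  unfolding friedrichs_cos_def
proof (rule cSup_upper)
  have "\<bar>a \<bullet> b\<bar> \<le> 1" if "norm a \<le> 1" "norm b \<le> 1" for a b :: 'a
    using Cauchy_Schwarz_ineq2[of a b] mult_le_one[of "norm a" "norm b"] that by auto
  then show "bdd_above {\<bar>u \<bullet> v\<bar> | u v. u \<in> U \<inter> orthogonal_comp (U \<inter> V) \<and>
      v \<in> V \<inter> orthogonal_comp (U \<inter> V) \<and> norm u \<le> 1 \<and> norm v \<le> 1}"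
    by (intro bdd_aboveI[of _ 1]) auto
qed (use assms in blast)

lemma friedrichs_cos_nonneg:
  "subspace U \<Longrightarrow> subspace V \<Longrightarrow> 0 \<le> friedrichs_cos U V"
  using friedrichs_cos_ge[of 0 U V 0] subspace_0 subspace_0[OF subspace_orthogonal_comp]
  by fastforce

lemma abs_inner_le_friedrichs_cos:
  fixes U V :: "'a::real_inner set"
  assumes "subspace U" "subspace V"
    and "u \<in> U" "v \<in> V" "u \<in> orthogonal_comp (U \<inter> V)" "v \<in> orthogonal_comp (U \<inter> V)"
  shows "\<bar>u \<bullet> v\<bar> \<le> friedrichs_cos U V * norm u * norm v"
proof (cases "u = 0 \<or> v = 0")
  case False
  have "sgn u \<in> U" "sgn v \<in> V" "sgn u \<in> orthogonal_comp (U \<inter> V)" "sgn v \<in> orthogonal_comp (U \<inter> V)"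
    using assms by (auto simp: sgn_div_norm intro!: subspace_scale subspace_orthogonal_comp)
  then have "\<bar>sgn u \<bullet> sgn v\<bar> \<le> friedrichs_cos U V"
    by (intro friedrichs_cos_ge) (auto simp: norm_sgn)
  moreover have "\<bar>sgn u \<bullet> sgn v\<bar> = \<bar>u \<bullet> v\<bar> / (norm u * norm v)"
    using False by (simp add: sgn_div_norm abs_mult field_simps)
  ultimately show ?thesis using False by (simp add: field_simps)
qed auto

text \<open>Each \<open>w = a + b\<close> in \<open>orthogonal_comp U + orthogonal_comp V\<close> satisfies
  \<open>\<bar>u \<bullet> w\<bar> \<le> norm b * dist u V\<close> for \<open>u \<in> U\<close>. Baire's theorem makes the constant uniform in \<open>w\<close>, and
  \<open>w = u\<close> then bounds the distance from \<open>u\<close> to \<open>V\<close> from below.\<close>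

lemma friedrichs_cos_less_1:
  fixes U V :: "'a::{real_inner,complete_space} set"
  assumes U: "subspace U" "closed U" and V: "subspace V" "closed V"
    and cl: "closed (orthogonal_comp U + orthogonal_comp V)"
  shows "friedrichs_cos U V < 1"
proof -
  define S where "S = orthogonal_comp (U \<inter> V)"
  have S_eq: "S = orthogonal_comp U + orthogonal_comp V"
    unfolding S_def using orthogonal_comp_Int[OF U V cl] .
  have S: "subspace S" "closed S"
    by (simp_all add: S_def subspace_orthogonal_comp closed_orthogonal_comp)
  \<comment> \<open>\<open>norm (q u)\<close> is the distance from \<open>u\<close> to
    \<open>V\<close>.\<close>
  define q where "q u = u - metric_proj V u" for u
  have proj: "metric_proj V u \<in> V" for u
    using metric_proj_affine_in[OF closed_affine_subspace_subspace[OF V]] .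
  have q_orth: "q u \<bullet> v = 0" if "v \<in> V" for u v
    unfolding q_def using metric_proj_subspace_orthogonal[OF V that] .
  \<comment> \<open>\<open>E n\<close> collects the \<open>w\<close> for which the constant
    \<open>n\<close> suffices. In the covering argument below, \<open>norm b\<close> is a constant
    for \<open>w = a + b\<close>, because \<open>a\<close> is orthogonal to \<open>u\<close> and
    \<open>b\<close> to \<open>V\<close>.\<close>
  define E where "E n = {w \<in> S. \<forall>u\<in>U. \<bar>u \<bullet> w\<bar> \<le> real n * norm (q u)}" for n
  have cover: "S \<subseteq> \<Union>(range E)"
  proof
    fix w assume w: "w \<in> S"
    then obtain a b where ab: "a \<in> orthogonal_comp U" "b \<in> orthogonal_comp V" "w = a + b"
      unfolding S_eq by (auto elim: set_plus_elim)
    obtain n where n: "norm b \<le> real n" using real_arch_simple by blast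
    have "\<bar>u \<bullet> w\<bar> \<le> real n * norm (q u)" if "u \<in> U" for u
    proof -
      have "u \<bullet> w = q u \<bullet> b"
        using ab that proj[of u]
        by (simp add: mem_orthogonal_comp q_def inner_add_right inner_diff_right inner_commute[of _ a]
            inner_commute[of _ b])
      then have "\<bar>u \<bullet> w\<bar> \<le> norm (q u) * norm b" by (simp add: Cauchy_Schwarz_ineq2)
      also have "\<dots> \<le> real n * norm (q u)" using n by (simp add: mult.commute mult_right_mono)
      finally show ?thesis .
    qed
    then show "w \<in> \<Union>(range E)" using w by (auto simp: E_def)
  qed
  have clE: "closed (E n)" for n
  proof -
    have "E n = S \<inter> (\<Inter>u\<in>U. {w. \<bar>u \<bullet> w\<bar> \<le> real n * norm (q u)})"
      by (auto simp: E_def)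
    then show ?thesis
      using S(2) by (auto intro!: closed_Int closed_INT closed_Collect_le continuous_intros)
  qed
  \<comment> \<open>Baire's theorem in \<open>S\<close>, which is completely metrizable as a closed
    subset of a complete space: otherwise the union of the sets \<open>E n\<close>, namely
    \<open>S\<close>, would have empty interior in itself.\<close>
  have "\<exists>n. (top_of_set S) interior_of (E n) \<noteq> {}"
  proof (rule ccontr)
    assume neg: "\<not> ?thesis"
    have "(top_of_set S) interior_of \<Union>(range E) = {}"
    proof (rule Baire_category_alt)
      show "completely_metrizable_space (top_of_set S) \<or>
        locally_compact_space (top_of_set S) \<and> regular_space (top_of_set S)"
        using completely_metrizable_space_closedin[OF completely_metrizable_space_euclidean, of S] S(2)
        by simp
      show "closedin (top_of_set S) T \<and> top_of_set S interior_of T = {}" if "T \<in> range E" for T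
        using that neg clE by (auto intro!: closed_subset simp: E_def)
    qed simp
    moreover have "\<Union>(range E) = S" using cover by (auto simp: E_def)
    ultimately have "S = {}" using interior_of_topspace[of "top_of_set S"] by simp
    then show False using subspace_0[OF S(1)] by simp
  qed
  then obtain n w0 where "w0 \<in> (top_of_set S) interior_of (E n)" by blast
  then obtain T where T: "openin (top_of_set S) T" "w0 \<in> T" "T \<subseteq> E n"
    by (auto simp: interior_of_def)
  then obtain \<epsilon> where \<epsilon>: "\<epsilon> > 0" "\<And>w. w \<in> S \<Longrightarrow> dist w w0 < \<epsilon> \<Longrightarrow> w \<in> E n"
    unfolding openin_euclidean_subtopology_iff by blast
  have w0: "w0 \<in> E n" using T by blast
  \<comment> \<open>Comparing two points of \<open>E n\<close> at distance \<epsilon> / 2 yields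
    \<epsilon> * \<open>norm u\<close> \<le> 4 * n * \<open>norm (q u)\<close>. Using
    \<open>n + 1\<close> avoids division by zero at \<open>n = 0\<close>, and the minimum with 1
    keeps \<open>1 - \<delta>\<^sup>2\<close> nonnegative.\<close>
  define \<delta> where "\<delta> = min 1 (\<epsilon> / (4 * (real n + 1)))"
  have \<delta>: "0 < \<delta>" "\<delta> \<le> 1" "\<delta> \<le> \<epsilon> / (4 * (real n + 1))"
    using \<epsilon>(1) by (auto simp: \<delta>_def)
  then have \<delta>_le: "4 * (real n + 1) * \<delta> \<le> \<epsilon>" by (simp add: field_simps)
  have q_ge: "\<delta> * norm u \<le> norm (q u)" if u: "u \<in> U" "u \<in> S" for u
  proof (cases "u = 0")
    case False
    \<comment> \<open>Moving from \<open>w0\<close> along \<open>u\<close> stays in the ball inside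
      \<open>E n\<close>; subtracting the bounds at \<open>w\<close> and \<open>w0\<close> isolates
      the inner product of \<open>u\<close> with its own direction, which is
      \<open>norm u\<close>.\<close>
    define w where "w = w0 + (\<epsilon> / 2) *\<^sub>R sgn u"
    have "w \<in> S" using w0 u S(1)
      by (auto simp: w_def E_def sgn_div_norm intro!: subspace_add subspace_scale)
    moreover have "dist w w0 < \<epsilon>" using \<epsilon>(1) False by (simp add: w_def dist_norm norm_sgn)
    ultimately have "w \<in> E n" by (rule \<epsilon>(2))
    then have "\<bar>u \<bullet> w\<bar> \<le> real n * norm (q u)" "\<bar>u \<bullet> w0\<bar> \<le> real n * norm (q u)"
      using w0 u(1) by (auto simp: E_def)
    moreover have "u \<bullet> w = u \<bullet> w0 + \<epsilon> / 2 * norm u"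
      using False by (simp add: w_def inner_add_right sgn_div_norm dot_square_norm power2_eq_square)
    ultimately have "\<epsilon> / 2 * norm u \<le> 2 * real n * norm (q u)" by linarith
    moreover have "4 * (real n + 1) * \<delta> * norm u \<le> \<epsilon> * norm u"
      using \<delta>_le by (rule mult_right_mono) simp
    ultimately have "(real n + 1) * (\<delta> * norm u) \<le> real n * norm (q u)"
      by (simp add: algebra_simps)
    also have "\<dots> \<le> (real n + 1) * norm (q u)" by (simp add: mult_right_mono)
    finally show ?thesis by (simp add: mult_le_cancel_left)
  qed (simp add: q_def)
  \<comment> \<open>The lower bound \<delta> on the sine of the angle between \<open>u\<close> and
    \<open>V\<close> becomes, by Pythagoras, an upper bound on its cosine.\<close>
  have "\<bar>u \<bullet> v\<bar> \<le> sqrt (1 - \<delta>\<^sup>2)"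
    if u: "u \<in> U \<inter> orthogonal_comp (U \<inter> V)" "norm u \<le> 1"
    and v: "v \<in> V \<inter> orthogonal_comp (U \<inter> V)" "norm v \<le> 1" for u v
  proof -
    define p where "p = metric_proj V u"
    have "q u \<bullet> p = 0" using q_orth proj by (simp add: p_def)
    then have "(norm u)\<^sup>2 = (norm p)\<^sup>2 + (norm (q u))\<^sup>2"
      by (simp add: power2_norm_eq_inner inner_diff_left inner_diff_right inner_commute q_def
          flip: p_def)
    moreover have "(\<delta> * norm u)\<^sup>2 \<le> (norm (q u))\<^sup>2"
      using q_ge[of u] u \<delta>(1) by (intro power_mono) (auto simp: S_def)
    ultimately have "(norm p)\<^sup>2 \<le> (1 - \<delta>\<^sup>2) * (norm u)\<^sup>2"
      by (simp add: algebra_simps power_mult_distrib)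
    also have "\<dots> \<le> (1 - \<delta>\<^sup>2) * 1"
      using u \<delta> by (intro mult_left_mono) (auto simp: power_le_one)
    finally have "norm p \<le> sqrt (1 - \<delta>\<^sup>2)" by (simp add: real_le_rsqrt)
    moreover have "u \<bullet> v = p \<bullet> v"
      using q_orth[of v u] v by (simp add: q_def p_def inner_diff_left)
    moreover have "\<bar>p \<bullet> v\<bar> \<le> norm p * norm v" by (rule Cauchy_Schwarz_ineq2)
    moreover have "norm p * norm v \<le> norm p" using v by (simp add: mult_left_le)
    ultimately show ?thesis by linarith
  qed
  then have "friedrichs_cos U V \<le> sqrt (1 - \<delta>\<^sup>2)"
    using U(1) V(1) by (intro friedrichs_cos_le) auto
  also have "\<dots> < 1" using \<delta>(1) by (simp add: real_sqrt_lt_1_iff)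
  finally show ?thesis .
qed


section \<open>Composing two best approximation mappings\<close>

text \<open>Here \<open>p1 + q1\<close> is the intermediate point. The sum \<open>S\<close> of the
  two squares equals its inner product with \<open>p1 + p2\<close>; Cauchy-Schwarz and the angle
  bound on \<open>norm (p1 + p2)\<close> give a quadratic inequality in \<open>S\<close>, which is
  then divided by \<open>S\<close>.\<close>

lemma two_step_sum_estimate:
  fixes p1 q1 p2 q2 :: "'a::real_inner"
  assumes orth: "p1 \<bullet> q1 = 0" "p2 \<bullet> q2 = 0"
    and y: "p1 + q1 = p2 + q2"
    and c: "\<bar>p1 \<bullet> p2\<bar> \<le> c * norm p1 * norm p2" "0 \<le> c"
  shows "(norm p1)\<^sup>2 + (norm p2)\<^sup>2 \<le> (1 + c) * (norm (p1 + q1))\<^sup>2"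
proof -
  define S where "S = (norm p1)\<^sup>2 + (norm p2)\<^sup>2"
  define N where "N = (norm (p1 + q1))\<^sup>2"
  have "S = (p1 + q1) \<bullet> p1 + (p2 + q2) \<bullet> p2"
    using orth by (simp add: S_def inner_add_left power2_norm_eq_inner inner_commute[of q1]
        inner_commute[of q2])
  also have "\<dots> = (p1 + q1) \<bullet> (p1 + p2)" by (simp add: y inner_add_right)
  also have "\<dots> \<le> norm (p1 + q1) * norm (p1 + p2)" by (rule norm_cauchy_schwarz)
  finally have "S\<^sup>2 \<le> (norm (p1 + q1) * norm (p1 + p2))\<^sup>2"
    by (intro power_mono) (auto simp: S_def)
  also have "\<dots> = N * (norm (p1 + p2))\<^sup>2" by (simp add: N_def power_mult_distrib)
  also have "\<dots> \<le> N * ((1 + c) * S)"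
  proof (rule mult_left_mono)
    have "2 * (p1 \<bullet> p2) \<le> c * (2 * norm p1 * norm p2)" using c(1) by (simp add: mult.assoc)
    also have "\<dots> \<le> c * S"
      unfolding S_def using sum_squares_bound[of "norm p1" "norm p2"] c(2) by (intro mult_left_mono)
    finally show "(norm (p1 + p2))\<^sup>2 \<le> (1 + c) * S"
      by (simp add: S_def power2_norm_eq_inner inner_add_left inner_add_right inner_commute
          algebra_simps)
  qed (simp add: N_def)
  finally have "S * S \<le> ((1 + c) * N) * S" by (simp add: power2_eq_square algebra_simps)
  moreover have "0 \<le> S" "0 \<le> (1 + c) * N" using c(2) by (auto simp: S_def N_def)
  ultimately have "S \<le> (1 + c) * N" by (cases "S = 0") (auto simp: mult_le_cancel_right)
  then show ?thesis by (simp add: S_def N_def)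
qed

text \<open>Splitting \<open>p2\<close> along \<open>p1\<close> and orthogonally to it writes
  \<open>(norm p2)\<^sup>2\<close> as \<open>i + j\<close>. The angle controls \<open>i\<close>,
  while \<open>j\<close> carries the contraction factor \<open>g\<close>; Cauchy-Schwarz for pairs
  recombines them.\<close>

lemma two_step_proj_estimate:
  fixes p1 q1 q1' p2 q2 :: "'a::real_inner"
  assumes orth: "p1 \<bullet> q1 = 0" "p1 \<bullet> q1' = 0" "p2 \<bullet> q2 = 0"
    and q1': "norm q1' \<le> g * norm q1" and g: "0 \<le> g" "g \<le> 1"
    and y: "p1 + q1' = p2 + q2"
    and c: "\<bar>p1 \<bullet> p2\<bar> \<le> c * norm p1 * norm p2"
  shows "(norm p2)\<^sup>2 \<le> (g\<^sup>2 + (1 - g\<^sup>2) * c\<^sup>2) * (norm (p1 + q1))\<^sup>2"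
proof -
  define e i j A where "e = (norm p2)\<^sup>2" and "i = p1 \<bullet> p2" and "j = q1' \<bullet> p2"
    and "A = i\<^sup>2 / (norm p1)\<^sup>2"
  define a b where "a = (norm p1)\<^sup>2" and "b = (norm q1)\<^sup>2"
  have pos: "0 \<le> a" "0 \<le> b" "0 \<le> A" "0 \<le> e" by (simp_all add: a_def b_def A_def e_def)
  have N: "(norm (p1 + q1))\<^sup>2 = a + b"
    using orth by (simp add: a_def b_def power2_norm_eq_inner inner_add_left inner_add_right
        inner_commute)
  have e: "e = i + j"
  proof -
    have "e = (p2 + q2) \<bullet> p2"
      using orth(3) by (simp add: e_def power2_norm_eq_inner inner_add_left inner_commute[of q2])
    then show ?thesis by (simp add: i_def j_def inner_add_left flip: y)
  qed
  have i2: "i\<^sup>2 = A * a" by (cases "p1 = 0") (auto simp: A_def a_def i_def)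
  have "i\<^sup>2 \<le> (c * norm p1 * norm p2)\<^sup>2"
    unfolding i_def using c by (metis abs_ge_zero power2_abs power_mono)
  then have A_le: "A \<le> c\<^sup>2 * e"
    by (cases "p1 = 0")
      (auto simp: A_def e_def power_mult_distrib field_simps)
  \<comment> \<open>\<open>w\<close> is the part of \<open>p2\<close> orthogonal to
    \<open>p1\<close>, and \<open>A\<close> is the squared norm of the other part. For
    \<open>p1 = 0\<close> division by zero gives \<open>A = 0\<close> and \<open>w = p2\<close>, as
    wanted.\<close>
  define w where "w = p2 - (i / a) *\<^sub>R p1"
  have w2: "(norm w)\<^sup>2 = e - A"
  proof (cases "p1 = 0")
    case False
    have "(norm w)\<^sup>2 = e - 2 * (i / a) * i + (i / a)\<^sup>2 * a"
      unfolding w_def power2_norm_eq_inner inner_diff_left inner_diff_right a_def e_def i_def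
      by (simp add: inner_commute power2_eq_square)
    also have "\<dots> = e - A"
      using False by (simp add: A_def a_def power2_eq_square field_simps)
    finally show ?thesis .
  qed (simp add: w_def A_def i_def e_def)
  have eA: "A \<le> e" using w2 by (metis diff_ge_0_iff_ge zero_le_power2)
  have "j = q1' \<bullet> w" using orth(2) by (simp add: j_def w_def inner_diff_right inner_commute)
  then have "\<bar>j\<bar> \<le> norm q1' * norm w" by (simp add: Cauchy_Schwarz_ineq2)
  also have "\<dots> \<le> (g * norm q1) * norm w" using q1' by (rule mult_right_mono) simp
  finally have "\<bar>j\<bar>\<^sup>2 \<le> (g * norm q1 * norm w)\<^sup>2" by (rule power_mono) simp
  then have j2: "j\<^sup>2 \<le> g\<^sup>2 * (e - A) * b" by (simp add: power_mult_distrib w2 b_def mult_ac)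
  define C where "C = g\<^sup>2 * (e - A)"
  have C0: "0 \<le> C" and jC: "j\<^sup>2 \<le> C * b" using eA j2 by (simp_all add: C_def)
  \<comment> \<open>This cross term completes
    \<open>(i + j)\<^sup>2 \<le> (A + C) * (a + b)\<close>, since \<open>i\<^sup>2 = A * a\<close>
    and \<open>j\<^sup>2 \<le> C * b\<close>. It is the inequality of arithmetic and geometric means
    for \<open>A * b\<close> and \<open>C * a\<close>.\<close>
  have ij: "2 * (i * j) \<le> A * b + C * a"
  proof -
    have "(2 * (i * j))\<^sup>2 = 4 * (i\<^sup>2 * j\<^sup>2)" by (simp add: power_mult_distrib)
    also have "\<dots> \<le> 4 * (A * a * (C * b))"
      using j2 pos i2 by (auto intro!: mult_left_mono simp: C_def)
    also have "\<dots> = (A * b + C * a)\<^sup>2 - (A * b - C * a)\<^sup>2"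
      by (simp add: power2_eq_square algebra_simps)
    also have "\<dots> \<le> (A * b + C * a)\<^sup>2" by simp
    finally have "(2 * (i * j))\<^sup>2 \<le> (A * b + C * a)\<^sup>2" .
    then show ?thesis by (rule power2_le_imp_le) (use pos C0 in simp)
  qed
  have "e\<^sup>2 = i\<^sup>2 + j\<^sup>2 + 2 * (i * j)" by (simp add: e power2_sum)
  also have "\<dots> \<le> (A + C) * (a + b)"
    using ij i2 jC by (simp add: algebra_simps)
  also have "A + C = g\<^sup>2 * e + (1 - g\<^sup>2) * A" by (simp add: C_def algebra_simps)
  also have "(g\<^sup>2 * e + (1 - g\<^sup>2) * A) * (a + b) \<le> (g\<^sup>2 * e + (1 - g\<^sup>2) * (c\<^sup>2 * e)) * (a + b)"
    using A_le g pos by (intro mult_right_mono add_left_mono mult_left_mono) (auto simp: power_le_one)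
  finally have "e * e \<le> ((g\<^sup>2 + (1 - g\<^sup>2) * c\<^sup>2) * (a + b)) * e"
    by (simp add: power2_eq_square algebra_simps)
  moreover have "0 \<le> (g\<^sup>2 + (1 - g\<^sup>2) * c\<^sup>2) * (a + b)"
    using pos g by (auto intro!: mult_nonneg_nonneg add_nonneg_nonneg simp: power_le_one)
  ultimately have "e \<le> (g\<^sup>2 + (1 - g\<^sup>2) * c\<^sup>2) * (a + b)"
    using pos by (cases "e = 0") (auto simp: mult_le_cancel_right)
  then show ?thesis by (simp add: e_def N)
qed

text \<open>The first bound writes the result as a convex combination, with weights
  \<open>g2\<^sup>2\<close> and \<open>1 - g2\<^sup>2\<close>, of the intermediate squared norm and
  \<open>(norm p2)\<^sup>2\<close>. The second adds the losses of both steps, at least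
  \<open>(1 - g1\<^sup>2) * b\<close> and \<open>(1 - g2\<^sup>2) * f\<close>.\<close>

lemma
  fixes p1 q1 q1' p2 q2 q2' :: "'a::real_inner"
  assumes orth: "p1 \<bullet> q1 = 0" "p1 \<bullet> q1' = 0" "p2 \<bullet> q2 = 0" "p2 \<bullet> q2' = 0"
    and q1': "norm q1' \<le> g1 * norm q1" and g1: "0 \<le> g1" "g1 \<le> 1"
    and q2': "norm q2' \<le> g2 * norm q2" and g2: "0 \<le> g2" "g2 \<le> 1"
    and y: "p1 + q1' = p2 + q2"
    and c: "\<bar>p1 \<bullet> p2\<bar> \<le> c * norm p1 * norm p2" "0 \<le> c"
  shows two_step_bound_prod:
      "(norm (p2 + q2'))\<^sup>2 \<le> (1 - (1 - g1\<^sup>2) * (1 - g2\<^sup>2) * (1 - c\<^sup>2)) * (norm (p1 + q1))\<^sup>2"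
    and two_step_bound_min:
      "(norm (p2 + q2'))\<^sup>2 \<le> (1 - min (1 - g1\<^sup>2) (1 - g2\<^sup>2) * (1 - c)) * (norm (p1 + q1))\<^sup>2"
proof -
  define a b b' e f f' where "a = (norm p1)\<^sup>2" and "b = (norm q1)\<^sup>2" and "b' = (norm q1')\<^sup>2"
    and "e = (norm p2)\<^sup>2" and "f = (norm q2)\<^sup>2" and "f' = (norm q2')\<^sup>2"
  have pos: "0 \<le> a" "0 \<le> b" "0 \<le> b'" "0 \<le> e" "0 \<le> f"
    by (simp_all add: a_def b_def b'_def e_def f_def)
  have pyth: "(norm (u + v))\<^sup>2 = (norm u)\<^sup>2 + (norm v)\<^sup>2" if "u \<bullet> v = 0" for u v :: 'a
    using that by (simp add: norm_add_Pythagorean orthogonal_def)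
  have N: "(norm (p1 + q1))\<^sup>2 = a + b" "(norm (p2 + q2'))\<^sup>2 = e + f'"
    using orth by (simp_all add: pyth a_def b_def e_def f'_def)
  have M: "(norm (p1 + q1'))\<^sup>2 = a + b'" "a + b' = e + f"
    using pyth[OF orth(2)] pyth[OF orth(3)] y by (simp_all add: a_def b'_def e_def f_def)
  have b': "b' \<le> g1\<^sup>2 * b" and f': "f' \<le> g2\<^sup>2 * f"
    using power_mono[OF q1', of 2] power_mono[OF q2', of 2]
    by (simp_all add: power_mult_distrib b_def b'_def f_def f'_def)
  have g: "0 \<le> 1 - g1\<^sup>2" "0 \<le> 1 - g2\<^sup>2" using g1 g2 by (simp_all add: power_le_one)
  have e: "e \<le> (g1\<^sup>2 + (1 - g1\<^sup>2) * c\<^sup>2) * (a + b)"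
    using two_step_proj_estimate[OF orth(1-3) q1' g1 y c(1)] by (simp add: N e_def)
  have "e + f' \<le> g2\<^sup>2 * (a + b') + (1 - g2\<^sup>2) * e" using f' M by (simp add: algebra_simps)
  also have "\<dots> \<le> g2\<^sup>2 * (a + b) + (1 - g2\<^sup>2) * ((g1\<^sup>2 + (1 - g1\<^sup>2) * c\<^sup>2) * (a + b))"
  proof (intro add_mono mult_left_mono)
    have "b' \<le> 1 * b" using b' mult_right_mono[of "g1\<^sup>2" 1 b] g pos by linarith
    then show "b' \<le> b" by simp
  qed (use e g in auto)
  also have "\<dots> = (1 - (1 - g1\<^sup>2) * (1 - g2\<^sup>2) * (1 - c\<^sup>2)) * (a + b)" by algebra
  finally show "(norm (p2 + q2'))\<^sup>2 \<le> (1 - (1 - g1\<^sup>2) * (1 - g2\<^sup>2) * (1 - c\<^sup>2)) * (norm (p1 + q1))\<^sup>2"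
    by (simp add: N)
  define \<mu> where "\<mu> = min (1 - g1\<^sup>2) (1 - g2\<^sup>2)"
  have \<mu>: "0 \<le> \<mu>" "\<mu> \<le> 1 - g1\<^sup>2" "\<mu> \<le> 1 - g2\<^sup>2" using g by (auto simp: \<mu>_def)
  have bb': "b' \<le> b" using b' mult_right_mono[of "g1\<^sup>2" 1 b] g pos by linarith
  \<comment> \<open>The sum estimate concerns the intermediate point, hence \<open>b'\<close>; the
    lines below pass from \<open>b'\<close> to the larger \<open>b\<close>, which costs nothing
    because \<open>c\<close> is nonnegative.\<close>
  have "a + e \<le> (1 + c) * (a + b')"
    using two_step_sum_estimate[OF orth(2,3) y c] by (simp add: M(1) a_def e_def)
  then have "(1 - c) * (a + b') \<le> b' + f" using M(2) by (simp add: algebra_simps)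
  moreover have "c * (b - b') \<ge> 0" using c bb' by simp
  ultimately have "(1 - c) * (a + b) \<le> b + f" by (simp add: algebra_simps)
  then have "\<mu> * ((1 - c) * (a + b)) \<le> \<mu> * (b + f)" using \<mu>(1) by (rule mult_left_mono)
  moreover have "\<mu> * b \<le> (1 - g1\<^sup>2) * b" "\<mu> * f \<le> (1 - g2\<^sup>2) * f"
    using \<mu> pos by (auto intro: mult_right_mono)
  ultimately have "e + f' \<le> (1 - \<mu> * (1 - c)) * (a + b)"
    using b' f' M(2) by (simp add: algebra_simps)
  then show "(norm (p2 + q2'))\<^sup>2 \<le> (1 - min (1 - g1\<^sup>2) (1 - g2\<^sup>2) * (1 - c)) * (norm (p1 + q1))\<^sup>2"
    by (simp add: N \<mu>_def)
qed

section \<open>Parallel subspaces, projections onto smaller affine subspaces, and fixed points of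
  compositions\<close>

lemma
  assumes "closed_affine_subspace U"
  shows subspace_par: "subspace (par U)" and closed_par: "closed (par U)"
proof -
  obtain u where u: "affine U" "closed U" "u \<in> U"
    using assms by (auto simp: closed_affine_subspace_def)
  show "subspace (par U)" "closed (par U)"
    using u by (simp_all add: par_eq[OF u(1,3)] affine_diffs_subspace_subtract
        closed_translation_subtract)
qed

lemma par_Int:
  assumes "affine U" "affine V" "U \<inter> V \<noteq> {}"
  shows "par (U \<inter> V) = par U \<inter> par V"
proof -
  obtain u where u: "u \<in> U" "u \<in> V" using assms(3) by blast
  then show ?thesis
    using assms par_eq[of U u] par_eq[of V u] par_eq[of "U \<inter> V" u] affine_Int[of U V]
    by (simp add: image_Int[symmetric] inj_def)
qed

text \<open>Equal projections onto \<open>U\<close> make \<open>y - x\<close> orthogonal to all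
  directions of \<open>U\<close>, hence to those of \<open>F\<close>. This transfers the projection
  condition of a BAM from its own fixed point set to the intersection.\<close>

lemma metric_proj_affine_subset_eq:
  fixes U F :: "'a::{real_inner,complete_space} set"
  assumes U: "closed_affine_subspace U" and F: "closed_affine_subspace F" "F \<subseteq> U"
    and eq: "metric_proj U y = metric_proj U x"
  shows "metric_proj F y = metric_proj F x"
proof (rule metric_proj_affine_eqI[OF F(1)])
  let ?p = "metric_proj F x"
  show p: "?p \<in> F" by (rule metric_proj_affine_in[OF F(1)])
  fix u assume u: "u \<in> F"
  have "(y - metric_proj U y) \<bullet> (u - ?p) = 0" "(x - metric_proj U x) \<bullet> (u - ?p) = 0"
    using metric_proj_affine_orthogonal[OF U] u p F(2) by blast+
  moreover have "(x - ?p) \<bullet> (u - ?p) = 0"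
    using metric_proj_affine_orthogonal[OF F(1)] u p by blast
  ultimately show "(y - ?p) \<bullet> (u - ?p) = 0"
    by (simp add: eq inner_diff_left)
qed

lemma
  assumes "is_BAM_with \<gamma> G"
  shows is_BAM_with_const: "0 \<le> \<gamma>" "\<gamma> < 1"
    and is_BAM_with_proj: "metric_proj (Fix G) (G x) = metric_proj (Fix G) x"
    and is_BAM_with_norm_le:
      "norm (G x - metric_proj (Fix G) x) \<le> \<gamma> * norm (x - metric_proj (Fix G) x)"
  using assms by (auto simp: is_BAM_with_def fun_eq_iff)

text \<open>\<open>x\<close> and \<open>G x\<close> have the same projection \<open>p\<close>, so by
  Pythagoras the distance from \<open>p\<close> to \<open>z\<close> is common to both and only the
  orthogonal part contracts.\<close>

lemma is_BAM_with_norm_le_Fix: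
  assumes G: "is_BAM_with \<gamma> G" and aff: "closed_affine_subspace (Fix G)" and z: "z \<in> Fix G"
  shows "(norm (G x - z))\<^sup>2 \<le> (norm (x - z))\<^sup>2 - (1 - \<gamma>\<^sup>2) * (norm (x - metric_proj (Fix G) x))\<^sup>2"
proof -
  define p where "p = metric_proj (Fix G) x"
  have pyth: "(norm (u - z))\<^sup>2 = (norm (u - p))\<^sup>2 + (norm (p - z))\<^sup>2"
    if "metric_proj (Fix G) u = p" for u
  proof -
    have "(u - p) \<bullet> (p - z) = 0"
      using metric_proj_affine_orthogonal[OF aff _ z, of p u] metric_proj_affine_in[OF aff, of u] that
      by simp
    then show ?thesis
      using norm_add_Pythagorean[of "u - p" "p - z"] by (simp add: orthogonal_def)
  qed
  have "(norm (G x - p))\<^sup>2 \<le> (\<gamma> * norm (x - p))\<^sup>2"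
    unfolding p_def by (intro power_mono is_BAM_with_norm_le[OF G]) simp
  then show ?thesis
    using pyth[of x] pyth[of "G x"] is_BAM_with_proj[OF G, of x]
    by (simp add: p_def power_mult_distrib algebra_simps)
qed

text \<open>Both maps do not increase the distance to a common fixed point \<open>z\<close>. If the
  composition returns to \<open>x\<close>, the decrease under \<open>G1\<close> must vanish, which
  forces \<open>x\<close> into \<open>Fix G1\<close> and then into \<open>Fix G2\<close>.\<close>

lemma Fix_comp_BAM:
  assumes G1: "is_BAM_with \<gamma>\<^sub>1 G1" "closed_affine_subspace (Fix G1)"
    and G2: "is_BAM_with \<gamma>\<^sub>2 G2" "closed_affine_subspace (Fix G2)"
    and ne: "Fix G1 \<inter> Fix G2 \<noteq> {}"
  shows "Fix (G2 \<circ> G1) = Fix G1 \<inter> Fix G2"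
proof
  obtain z where z: "z \<in> Fix G1" "z \<in> Fix G2" using ne by blast
  show "Fix (G2 \<circ> G1) \<subseteq> Fix G1 \<inter> Fix G2"
  proof
    fix x assume "x \<in> Fix (G2 \<circ> G1)"
    then have x: "G2 (G1 x) = x" by (simp add: Fix_def)
    have pos: "0 < 1 - \<gamma>\<^sub>1\<^sup>2" "0 < 1 - \<gamma>\<^sub>2\<^sup>2"
      using is_BAM_with_const[OF G1(1)] is_BAM_with_const[OF G2(1)]
      by (simp_all add: power_less_one_iff abs_square_less_1)
    have "0 \<le> (1 - \<gamma>\<^sub>2\<^sup>2) * (norm (G1 x - metric_proj (Fix G2) (G1 x)))\<^sup>2"
      using pos by simp
    then have "(1 - \<gamma>\<^sub>1\<^sup>2) * (norm (x - metric_proj (Fix G1) x))\<^sup>2 \<le> 0"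
      using is_BAM_with_norm_le_Fix[OF G1 z(1), of x] is_BAM_with_norm_le_Fix[OF G2 z(2), of "G1 x"]
      unfolding x by linarith
    then have "x = metric_proj (Fix G1) x" using pos by (simp add: mult_le_0_iff)
    then have "x \<in> Fix G1" using metric_proj_affine_in[OF G1(2), of x] by simp
    then show "x \<in> Fix G1 \<inter> Fix G2" using x by (simp add: Fix_def)
  qed
qed (auto simp: Fix_def)

text \<open>\<open>t\<close> stays free so that either estimate can supply it: \<open>r\<close>,
  \<open>s\<close> and the constant in \<open>is_BAM_comp\<close> are all obtained from
  here.\<close>

lemma is_BAM_with_comp:
  fixes G1 G2 :: "'a::{real_inner,complete_space} \<Rightarrow> 'a"
  assumes G1: "is_BAM_with \<gamma>\<^sub>1 G1" "closed_affine_subspace (Fix G1)"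
    and G2: "is_BAM_with \<gamma>\<^sub>2 G2" "closed_affine_subspace (Fix G2)"
    and ne: "Fix G1 \<inter> Fix G2 \<noteq> {}"
    and c_def: "c = friedrichs_cos (par (Fix G1)) (par (Fix G2))"
    and t: "0 \<le> t" "t < 1"
      "1 - (1 - \<gamma>\<^sub>1\<^sup>2) * (1 - \<gamma>\<^sub>2\<^sup>2) * (1 - c\<^sup>2) \<le> t\<^sup>2 \<or>
       1 - min (1 - \<gamma>\<^sub>1\<^sup>2) (1 - \<gamma>\<^sub>2\<^sup>2) * (1 - c) \<le> t\<^sup>2"
  shows "is_BAM_with t (G2 \<circ> G1)"
proof -
  let ?U = "Fix G1" and ?V = "Fix G2"
  have Fix_eq: "Fix (G2 \<circ> G1) = ?U \<inter> ?V" using Fix_comp_BAM[OF G1 G2 ne] .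
  have F: "closed_affine_subspace (?U \<inter> ?V)"
    using closed_affine_subspace_Int[OF G1(2) G2(2) ne] .
  have proj1: "metric_proj (?U \<inter> ?V) (G1 x) = metric_proj (?U \<inter> ?V) x" for x
    by (rule metric_proj_affine_subset_eq[OF G1(2) F _ is_BAM_with_proj[OF G1(1)]]) simp
  have proj2: "metric_proj (?U \<inter> ?V) (G2 x) = metric_proj (?U \<inter> ?V) x" for x
    by (rule metric_proj_affine_subset_eq[OF G2(2) F _ is_BAM_with_proj[OF G2(1)]]) simp
  have c0: "0 \<le> c" unfolding c_def
    using friedrichs_cos_nonneg subspace_par G1(2) G2(2) by blast
  have "norm (G2 (G1 x) - metric_proj (?U \<inter> ?V) x) \<le> t * norm (x - metric_proj (?U \<inter> ?V) x)" for x
  proof -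
    define y where "y = G1 x"
    define o0 where "o0 = metric_proj (?U \<inter> ?V) x"
    define p1 q1 q1' where "p1 = metric_proj ?U x - o0" and "q1 = x - metric_proj ?U x"
      and "q1' = y - metric_proj ?U x"
    define p2 q2 q2' where "p2 = metric_proj ?V y - o0" and "q2 = y - metric_proj ?V y"
      and "q2' = G2 y - metric_proj ?V y"
    have o0: "o0 \<in> ?U" "o0 \<in> ?V" using metric_proj_affine_in[OF F, of x] by (auto simp: o0_def)
    have in1: "metric_proj ?U x \<in> ?U" and in2: "metric_proj ?V y \<in> ?V"
      using metric_proj_affine_in G1(2) G2(2) by blast+
    have q1_orth: "q1 \<bullet> (u - v) = 0" if "u \<in> ?U" "v \<in> ?U" for u v
      unfolding q1_def using metric_proj_affine_orthogonal[OF G1(2) that] .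
    have q2_orth: "q2 \<bullet> (u - v) = 0" if "u \<in> ?V" "v \<in> ?V" for u v
      unfolding q2_def using metric_proj_affine_orthogonal[OF G2(2) that] .
    have q1'_orth: "q1' \<bullet> (u - v) = 0" if "u \<in> ?U" "v \<in> ?U" for u v
      using metric_proj_affine_orthogonal[OF G1(2) that, of y] is_BAM_with_proj[OF G1(1), of x]
      by (simp add: q1'_def y_def)
    have q2'_orth: "q2' \<bullet> (u - v) = 0" if "u \<in> ?V" "v \<in> ?V" for u v
      using metric_proj_affine_orthogonal[OF G2(2) that, of "G2 y"] is_BAM_with_proj[OF G2(1), of y]
      by (simp add: q2'_def)
    have orth: "p1 \<bullet> q1 = 0" "p1 \<bullet> q1' = 0" "p2 \<bullet> q2 = 0" "p2 \<bullet> q2' = 0"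
      using q1_orth[OF in1 o0(1)] q1'_orth[OF in1 o0(1)] q2_orth[OF in2 o0(2)] q2'_orth[OF in2 o0(2)]
      by (simp_all add: p1_def p2_def inner_commute)
    have par: "par ?U = (\<lambda>x. x - o0) ` ?U" "par ?V = (\<lambda>x. x - o0) ` ?V"
      using o0 G1(2) G2(2) by (auto intro!: par_eq simp: closed_affine_subspace_def)
    \<comment> \<open>\<open>p1 = (x - o0) - q1\<close> and \<open>p2 = (y - o0) - q2\<close>, where
      all four differences are orthogonal to the directions of the intersection; for
      \<open>y - o0\<close> this uses that \<open>o0\<close> is also the projection of
      \<open>y\<close>.\<close>
    have perp: "p1 \<in> orthogonal_comp (par ?U \<inter> par ?V)" "p2 \<in> orthogonal_comp (par ?U \<inter> par ?V)"
    proof -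
      have "p1 \<bullet> w = 0 \<and> p2 \<bullet> w = 0" if w: "w \<in> par ?U \<inter> par ?V" for w
      proof -
        obtain u where u: "u \<in> ?U" "u \<in> ?V" "w = u - o0" using w by (auto simp: par)
        have "(x - o0) \<bullet> (u - o0) = 0" "(y - o0) \<bullet> (u - o0) = 0"
          using metric_proj_affine_orthogonal[OF F, of u o0 x]
            metric_proj_affine_orthogonal[OF F, of u o0 y] u o0
          by (simp_all add: y_def proj1 flip: o0_def)
        moreover have "q1 \<bullet> (u - o0) = 0" "q2 \<bullet> (u - o0) = 0"
          using q1_orth q2_orth u o0 by auto
        ultimately show ?thesis
          by (simp add: u(3) p1_def p2_def q1_def q2_def inner_diff_left)
      qed
      then show "p1 \<in> orthogonal_comp (par ?U \<inter> par ?V)" "p2 \<in> orthogonal_comp (par ?U \<inter> par ?V)"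
        by (simp_all add: mem_orthogonal_comp)
    qed
    have mem: "p1 \<in> par ?U" "p2 \<in> par ?V" using in1 in2 by (auto simp: par p1_def p2_def)
    have cb: "\<bar>p1 \<bullet> p2\<bar> \<le> c * norm p1 * norm p2"
      unfolding c_def
      by (rule abs_inner_le_friedrichs_cos[OF subspace_par[OF G1(2)] subspace_par[OF G2(2)] mem perp])
    have q1': "norm q1' \<le> \<gamma>\<^sub>1 * norm q1"
      using is_BAM_with_norm_le[OF G1(1)] by (simp add: q1'_def q1_def y_def)
    have q2': "norm q2' \<le> \<gamma>\<^sub>2 * norm q2"
      using is_BAM_with_norm_le[OF G2(1)] by (simp add: q2'_def q2_def)
    have g: "0 \<le> \<gamma>\<^sub>1" "\<gamma>\<^sub>1 \<le> 1" "0 \<le> \<gamma>\<^sub>2" "\<gamma>\<^sub>2 \<le> 1"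
      using is_BAM_with_const[OF G1(1)] is_BAM_with_const[OF G2(1)] by auto
    have y: "p1 + q1' = p2 + q2" by (simp add: p1_def q1'_def p2_def q2_def)
    note bounds = two_step_bound_prod[OF orth q1' g(1,2) q2' g(3,4) y cb c0]
      two_step_bound_min[OF orth q1' g(1,2) q2' g(3,4) y cb c0]
    have "(norm (p2 + q2'))\<^sup>2 \<le> t\<^sup>2 * (norm (p1 + q1))\<^sup>2"
      using t(3) bounds mult_right_mono[OF _ zero_le_power2[of "norm (p1 + q1)"]]
      by (meson order_trans)
    then have "(norm (p2 + q2'))\<^sup>2 \<le> (t * norm (p1 + q1))\<^sup>2" by (simp add: power_mult_distrib)
    then have "norm (p2 + q2') \<le> t * norm (p1 + q1)"
      by (rule power2_le_imp_le) (use t(1) in simp)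
    then show ?thesis by (simp add: p1_def q1_def p2_def q2'_def y_def o0_def)
  qed
  then show ?thesis
    unfolding is_BAM_with_def Fix_eq
    using t F closed_affine_subspace_rules[OF F] proj1 proj2 by (auto simp: fun_eq_iff)
qed

text \<open>Closedness of the sum gives \<open>c < 1\<close>, so \<open>d\<close> is positive and
  the product bound yields a constant below 1.\<close>

lemma is_BAM_comp:
  fixes G1 G2 :: "'a::{real_inner,complete_space} \<Rightarrow> 'a"
  assumes G1: "is_BAM G1" "closed_affine_subspace (Fix G1)"
    and G2: "is_BAM G2" "closed_affine_subspace (Fix G2)"
    and ne: "Fix G1 \<inter> Fix G2 \<noteq> {}"
    and cl: "closed (orthogonal_comp (par (Fix G1)) + orthogonal_comp (par (Fix G2)))"
  shows "is_BAM (G2 \<circ> G1)"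
proof -
  obtain \<gamma>\<^sub>1 \<gamma>\<^sub>2 where g: "is_BAM_with \<gamma>\<^sub>1 G1" "is_BAM_with \<gamma>\<^sub>2 G2"
    using G1 G2 by (auto simp: is_BAM_def)
  define c where "c = friedrichs_cos (par (Fix G1)) (par (Fix G2))"
  have c: "0 \<le> c" "c < 1"
    unfolding c_def using subspace_par closed_par G1(2) G2(2) cl
    by (auto intro!: friedrichs_cos_nonneg friedrichs_cos_less_1)
  define d where "d = (1 - \<gamma>\<^sub>1\<^sup>2) * (1 - \<gamma>\<^sub>2\<^sup>2) * (1 - c\<^sup>2)"
  have "0 < 1 - \<gamma>\<^sub>1\<^sup>2" "0 < 1 - \<gamma>\<^sub>2\<^sup>2" "0 < 1 - c\<^sup>2"
    using is_BAM_with_const[OF g(1)] is_BAM_with_const[OF g(2)] c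
    by (simp_all add: abs_square_less_1)
  then have d: "0 < d" "d \<le> 1" by (auto simp: d_def intro!: mult_le_one)
  have "is_BAM_with (sqrt (1 - d)) (G2 \<circ> G1)"
    using d by (intro is_BAM_with_comp[OF g(1) G1(2) g(2) G2(2) ne c_def]) (auto simp: d_def)
  then show ?thesis by (auto simp: is_BAM_def)
qed

text \<open>The projection onto \<open>Fix G\<close> is constant along an orbit, so the one-step
  contraction can be iterated around the same point.\<close>

lemma is_BAM_with_funpow:
  assumes "is_BAM_with \<gamma> G"
  shows "norm ((G ^^ k) x - metric_proj (Fix G) x) \<le> \<gamma> ^ k * norm (x - metric_proj (Fix G) x)"
proof (induction k arbitrary: x)
  case (Suc k)
  have "norm ((G ^^ Suc k) x - metric_proj (Fix G) x) \<le> \<gamma> ^ k * norm (G x - metric_proj (Fix G) x)"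
    using Suc[of "G x"] by (simp add: is_BAM_with_proj[OF assms] funpow_swap1)
  also have "\<dots> \<le> \<gamma> ^ k * (\<gamma> * norm (x - metric_proj (Fix G) x))"
    using is_BAM_with_norm_le[OF assms] is_BAM_with_const[OF assms] by (intro mult_left_mono) auto
  finally show ?case by (simp add: mult_ac)
qed simp

section \<open>Finite compositions, by induction on the number of maps\<close>

theorem theorem4p4:
  fixes m :: nat
    and \<gamma> :: "nat \<Rightarrow> real"
    and G :: "nat \<Rightarrow> 'a::{real_inner,complete_space} \<Rightarrow> 'a"
    and U :: "nat \<Rightarrow> 'a set"
  assumes "m \<ge> 1"
    and "\<And>i. i \<in> {1..m} \<Longrightarrow> 0 \<le> \<gamma> i \<and> \<gamma> i < 1"
    and "\<And>i. i \<in> {1..m} \<Longrightarrow> is_BAM_with (\<gamma> i) (G i)"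
    and "\<And>i. i \<in> {1..m} \<Longrightarrow> U i = Fix (G i)"
    and "\<And>i. i \<in> {1..m} \<Longrightarrow> closed_affine_subspace (U i)"
    and "(\<Inter>i\<in>{1..m}. U i) \<noteq> {}"
    and "\<And>i. i \<in> {1..m} \<Longrightarrow> closed (\<Sum>j\<in>{1..i}. orthogonal_comp (par (U j)))"
  shows "(\<forall>k\<in>{1..m}. Fix (comp_upto G k) = (\<Inter>i\<in>{1..k}. Fix (G i)) \<and>
                      closed_affine_subspace (Fix (comp_upto G k)))
    \<and> is_BAM (comp_upto G m)
    \<and> (m = 2 \<longrightarrow>
        (let c = friedrichs_cos (par (U 1)) (par (U 2));
             r = Max ((\<lambda>i. sqrt ((\<gamma> i)\<^sup>2 + (1 - (\<gamma> i)\<^sup>2) * ((1 + c) / 2))) ` {1..m});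
             s = sqrt ((\<gamma> 1)\<^sup>2 + (\<gamma> 2)\<^sup>2 - (\<gamma> 1)\<^sup>2 * (\<gamma> 2)\<^sup>2
                       + (1 - (\<gamma> 1)\<^sup>2) * (1 - (\<gamma> 2)\<^sup>2) * ((1 + c)\<^sup>2 / 4))
         in 0 \<le> min r s \<and> min r s < 1 \<and> is_BAM_with (min r s) (G 2 \<circ> G 1)))
    \<and> (\<exists>\<gamma>'. 0 \<le> \<gamma>' \<and> \<gamma>' < 1 \<and>
        (\<forall>x. \<forall>k::nat.
          norm ((comp_upto G m ^^ k) x - metric_proj (\<Inter>i\<in>{1..m}. U i) x)
            \<le> \<gamma>' ^ k * norm (x - metric_proj (\<Inter>i\<in>{1..m}. U i) x)))"
proof -
  \<comment> \<open>The last conjunct keeps the induction going: it turns the closedness assumption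
    for the sum up to \<open>Suc k\<close> into the closedness that \<open>is_BAM_comp\<close>
    requires of \<open>comp_upto G k\<close> and \<open>G (Suc k)\<close>.\<close>
  have main: "is_BAM (comp_upto G k) \<and> Fix (comp_upto G k) = (\<Inter>i\<in>{1..k}. Fix (G i))
      \<and> closed_affine_subspace (Fix (comp_upto G k))
      \<and> orthogonal_comp (par (Fix (comp_upto G k))) = (\<Sum>j\<in>{1..k}. orthogonal_comp (par (U j)))"
    if "1 \<le> k" "k \<le> m" for k
    using that
  proof (induction k rule: dec_induct)
    case base
    then have "U 1 = Fix (G 1)" "closed_affine_subspace (U 1)" "is_BAM_with (\<gamma> 1) (G 1)"
      using assms(3-5)[of 1] by auto
    then show ?case by (auto simp: is_BAM_def)
  next
    case (step k)
    let ?T = "comp_upto G k" and ?H = "G (Suc k)"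
    have T: "is_BAM ?T" "Fix ?T = (\<Inter>i\<in>{1..k}. Fix (G i))" "closed_affine_subspace (Fix ?T)"
      "orthogonal_comp (par (Fix ?T)) = (\<Sum>j\<in>{1..k}. orthogonal_comp (par (U j)))"
      using step by auto
    have "Suc k \<in> {1..m}" using step by auto
    note H = assms(3)[OF this] assms(4)[OF this] assms(5)[OF this, unfolded assms(4)[OF this]]
      assms(7)[OF this]
    have BH: "is_BAM ?H" using H(1) by (auto simp: is_BAM_def)
    have ivl: "{1..Suc k} = insert (Suc k) {1..k}" by auto
    have "(\<Inter>i\<in>{1..m}. U i) \<subseteq> (\<Inter>i\<in>{1..k}. Fix (G i)) \<inter> Fix ?H"
      using step assms(4) by fastforce
    then have ne: "Fix ?T \<inter> Fix ?H \<noteq> {}" unfolding T(2) using assms(6) by blast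
    have sum_eq: "(\<Sum>j\<in>{1..Suc k}. orthogonal_comp (par (U j)))
        = orthogonal_comp (par (Fix ?T)) + orthogonal_comp (par (Fix ?H))"
      using H(2) T(4) by (simp add: ivl add.commute)
    have cl: "closed (orthogonal_comp (par (Fix ?T)) + orthogonal_comp (par (Fix ?H)))"
      using H(4) unfolding sum_eq .
    obtain \<tau> where \<tau>: "is_BAM_with \<tau> ?T" using T(1) by (auto simp: is_BAM_def)
    have Fix_eq: "Fix (comp_upto G (Suc k)) = Fix ?T \<inter> Fix ?H"
      using Fix_comp_BAM[OF \<tau> T(3) H(1,3) ne] by simp
    have "par (Fix ?T \<inter> Fix ?H) = par (Fix ?T) \<inter> par (Fix ?H)"
      using T(3) H(3) ne by (intro par_Int) (auto simp: closed_affine_subspace_def)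
    then have "orthogonal_comp (par (Fix (comp_upto G (Suc k))))
        = (\<Sum>j\<in>{1..Suc k}. orthogonal_comp (par (U j)))"
      using orthogonal_comp_Int[OF subspace_par closed_par subspace_par closed_par cl] T(3) H(3)
      unfolding sum_eq Fix_eq by simp
    moreover have "is_BAM (comp_upto G (Suc k))"
      using is_BAM_comp[OF T(1,3) BH H(3) ne cl] by simp
    moreover have "closed_affine_subspace (Fix (comp_upto G (Suc k)))"
      unfolding Fix_eq using closed_affine_subspace_Int[OF T(3) H(3) ne] .
    moreover have "Fix (comp_upto G (Suc k)) = (\<Inter>i\<in>{1..Suc k}. Fix (G i))"
      unfolding Fix_eq T(2) ivl by auto
    ultimately show ?case by blast
  qed
  have bam: "is_BAM (comp_upto G m)" and Fix_m: "Fix (comp_upto G m) = (\<Inter>i\<in>{1..m}. U i)"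
    using main[of m] assms(1,4) by auto
  have power: "\<exists>\<gamma>'. 0 \<le> \<gamma>' \<and> \<gamma>' < 1 \<and> (\<forall>x. \<forall>k::nat.
      norm ((comp_upto G m ^^ k) x - metric_proj (\<Inter>i\<in>{1..m}. U i) x)
        \<le> \<gamma>' ^ k * norm (x - metric_proj (\<Inter>i\<in>{1..m}. U i) x))"
    using bam is_BAM_with_const is_BAM_with_funpow unfolding is_BAM_def Fix_m[symmetric] by metis
  have two: "0 \<le> min r s \<and> min r s < 1 \<and> is_BAM_with (min r s) (G 2 \<circ> G 1)"
    if m2: "m = 2" and c_eq: "c = friedrichs_cos (par (U 1)) (par (U 2))"
      and r_eq: "r = Max ((\<lambda>i. sqrt ((\<gamma> i)\<^sup>2 + (1 - (\<gamma> i)\<^sup>2) * ((1 + c) / 2))) ` {1..m})"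
      and s_eq: "s = sqrt ((\<gamma> 1)\<^sup>2 + (\<gamma> 2)\<^sup>2 - (\<gamma> 1)\<^sup>2 * (\<gamma> 2)\<^sup>2
                       + (1 - (\<gamma> 1)\<^sup>2) * (1 - (\<gamma> 2)\<^sup>2) * ((1 + c)\<^sup>2 / 4))" for c r s
  proof -
    have i12: "1 \<in> {1..m}" "2 \<in> {1..m}" "{1..m} = {1, 2}" using m2 by auto
    note G1 = assms(3)[OF i12(1)] assms(5)[OF i12(1), unfolded assms(4)[OF i12(1)]]
      and G2 = assms(3)[OF i12(2)] assms(5)[OF i12(2), unfolded assms(4)[OF i12(2)]]
    have U12: "U 1 = Fix (G 1)" "U 2 = Fix (G 2)" using assms(4) i12 by auto
    have ne: "Fix (G 1) \<inter> Fix (G 2) \<noteq> {}" using assms(6) unfolding i12(3) U12[symmetric] by simp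
    have c_def: "c = friedrichs_cos (par (Fix (G 1))) (par (Fix (G 2)))" using c_eq U12 by simp
    have cl: "closed (orthogonal_comp (par (Fix (G 1))) + orthogonal_comp (par (Fix (G 2))))"
      using assms(7)[OF i12(2)] U12 i12(3) m2 by simp
    have c: "0 \<le> c" "c < 1"
      unfolding c_def using subspace_par closed_par G1(2) G2(2) cl
      by (auto intro!: friedrichs_cos_nonneg friedrichs_cos_less_1)
    define a b where "a = 1 - (\<gamma> 1)\<^sup>2" and "b = 1 - (\<gamma> 2)\<^sup>2"
    have ab: "0 < a" "a \<le> 1" "0 < b" "b \<le> 1"
      using assms(2) i12 by (auto simp: a_def b_def abs_square_less_1)
    \<comment> \<open>Writing \<open>r\<close> and \<open>s\<close> as square roots of 1 minus a
      loss makes them comparable with the two bounds of \<open>is_BAM_with_comp\<close>.\<close>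
    have r: "r = max (sqrt (1 - a * ((1 - c) / 2))) (sqrt (1 - b * ((1 - c) / 2)))"
      unfolding r_eq i12(3) by (simp add: a_def b_def field_simps)
    have s: "s = sqrt (1 - a * b * (1 - (1 + c)\<^sup>2 / 4))"
      unfolding s_eq by (simp add: a_def b_def algebra_simps)
    have r_ge: "1 - a * ((1 - c) / 2) \<le> r\<^sup>2" "1 - b * ((1 - c) / 2) \<le> r\<^sup>2"
      unfolding r by (auto intro: sqrt_le_D)
    have r_BAM: "0 \<le> r \<and> r < 1 \<and> is_BAM_with r (G 2 \<circ> G 1)"
    proof -
      have "a * ((1 - c) / 2) \<le> 1" "b * ((1 - c) / 2) \<le> 1"
        by (intro mult_le_one; use ab c in simp)+
      then have "0 \<le> r" unfolding r by (simp add: le_max_iff_disj)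
      moreover have "r < 1" unfolding r using ab c by simp
      moreover have "1 - min a b * (1 - c) \<le> r\<^sup>2"
      proof -
        \<comment> \<open>The loss in \<open>r\<close> is half of the loss that the second bound
          provides.\<close>
        have "min a b * ((1 - c) / 2) \<le> min a b * (1 - c)"
          using ab c by (intro mult_left_mono) auto
        moreover have "1 - min a b * ((1 - c) / 2) \<le> r\<^sup>2"
          using r_ge by (cases "a \<le> b") (simp_all add: min_def)
        ultimately show ?thesis by linarith
      qed
      ultimately show ?thesis
        using is_BAM_with_comp[OF G1 G2 ne c_def] by (simp add: a_def b_def)
    qed
    have s_BAM: "0 \<le> s \<and> s < 1 \<and> is_BAM_with s (G 2 \<circ> G 1)"
    proof -
      \<comment> \<open>Since \<open>c < 1\<close>, the mean \<open>(1 + c) / 2\<close> lies between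
        \<open>c\<close> and 1: \<open>s\<close> is thus weaker than the product bound, yet still
        below 1.\<close>
      have c2: "c\<^sup>2 \<le> (1 + c)\<^sup>2 / 4" "(1 + c)\<^sup>2 / 4 < 1"
        using power_mono[of c "(1 + c) / 2" 2] power_strict_mono[of "(1 + c) / 2" 1 2] c
        by (auto simp: power_divide)
      have ab': "0 < a * b" "a * b \<le> 1" using ab by (auto intro: mult_le_one)
      have le1: "a * b * (1 - (1 + c)\<^sup>2 / 4) \<le> 1"
        by (rule mult_le_one) (use ab' c2 in auto)
      then have "0 \<le> s" "s\<^sup>2 = 1 - a * b * (1 - (1 + c)\<^sup>2 / 4)" unfolding s by simp_all
      moreover have "s < 1" unfolding s using ab' c2 by simp
      moreover have "a * b * (1 - (1 + c)\<^sup>2 / 4) \<le> a * b * (1 - c\<^sup>2)"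
        using ab' c2 by (intro mult_left_mono) auto
      ultimately show ?thesis
        using is_BAM_with_comp[OF G1 G2 ne c_def, of s] by (simp add: a_def b_def)
    qed
    show ?thesis using r_BAM s_BAM by (simp add: min_def)
  qed
  show ?thesis
    unfolding Let_def
  proof (intro conjI[OF _ conjI[OF bam conjI[OF _ power]]] ballI impI)
    fix k assume "k \<in> {1..m}"
    then show "Fix (comp_upto G k) = (\<Inter>i\<in>{1..k}. Fix (G i)) \<and>
        closed_affine_subspace (Fix (comp_upto G k))"
      using main[of k] by auto
  qed (rule two[OF _ refl refl refl])
qed

end
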